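(* Let $T$ be a tree, let $v$ be a vertex of $T$ with $\deg v\ge 2$, let $V_1,\ldots,V_k$ be the vertex sets of the connected components of $T-v$, and let $T_i=T[V_i\cup\{v\}]$ for $1\le i\le k$. Partition the indices $1,\ldots,k$ into \begin{align*} I&=\{i:\gamma_P(T_i;\{v\})=\gamma_P(T_i) \text{ and } 1+\gamma_P(T_i-v)\neq\gamma_P(T_i;\{v\})\},\\ I'&=\{i:\gamma_P(T_i;\{v\})=\gamma_P(T_i) \text{ and } 1+\gamma_P(T_i-v)=\gamma_P(T_i;\{v\})\},\\ J&=\{i:\gamma_P(T_i;\{v\})\neq\gamma_P(T_i)\}. \end{align*} Let $g=-k+\sum_{i=1}^k\gamma_P(T_i;\{v\})$. Then \[\gamma_P(T)=\begin{cases} g+1 & \text{if } |I|\ge 2 \text{ or } |J|=0,\\ g & \text{if } |I|\le 1 \text{ and } |J|\ge 1.\end{cases}\]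
   Context: All graphs are finite, simple and undirected. $H[W]$ denotes the subgraph induced by $W$, and $H-v$ the graph obtained by deleting $v$. $N(v)$ denotes the set of neighbors of $v$, $N[v]=N(v)\cup\{v\}$, $N[S]=\bigcup_{v\in S}N[v]$. For $S\subseteq V$, the set $PD(S)$ is defined by: initially $PD(S)=N[S]$; while there exists $v\in PD(S)$ with $|N(v)\setminus PD(S)|=1$, replace $PD(S)$ by $PD(S)\cup N(v)$. $S$ is a power dominating set of $G$ if at the end $PD(S)=V(G)$. $\gamma_P(G)$ is the minimum cardinality of a power dominating set of $G$, and for $X\subseteq V(G)$, $\gamma_P(G;X)$ is the minimum cardinality of a power dominating set of $G$ containing $X$. *)

theory Defs
  imports "Graph_Theory.Graph_Theory"
begin

text \<open>
  A finite simple undirected graph is a finite symmetric digraph without loops and parallel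
  arcs (locale \<^locale>\<open>graph\<close>). In this encoding every edge gives a directed cycle of length 2,
  so the library's \<^const>\<open>tree\<close> fails for every symmetric digraph with an edge. Cycles of the
  undirected graph are the directed cycles of length at least 3.
\<close>

definition undirected_tree :: "('a, 'b) pre_digraph \<Rightarrow> bool" where
  "undirected_tree G \<longleftrightarrow> graph G \<and> Digraph_Component.connected G \<and>
     \<not> (\<exists>p. pre_digraph.cycle G p \<and> 3 \<le> length p)"

text \<open>For symmetric digraphs the strongly connected components are the connected components
  of the undirected graph.\<close>

definition component_verts :: "('a, 'b) pre_digraph \<Rightarrow> 'a set set" where
  "component_verts G = verts ` pre_digraph.sccs G"

definition nbhd :: "('a, 'b) pre_digraph \<Rightarrow> 'a \<Rightarrow> 'a set" where
  "nbhd G v = {w. v \<rightarrow>\<^bsub>G\<^esub> w}"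

definition closed_nbhd :: "('a, 'b) pre_digraph \<Rightarrow> 'a \<Rightarrow> 'a set" where
  "closed_nbhd G v = nbhd G v \<union> {v}"

inductive pd_step :: "('a, 'b) pre_digraph \<Rightarrow> 'a set \<Rightarrow> 'a set \<Rightarrow> bool" for G where
  "v \<in> P \<Longrightarrow> card (nbhd G v - P) = 1 \<Longrightarrow> pd_step G P (P \<union> nbhd G v)"

text \<open>\<open>PD_result G S P\<close>: the while loop started from \<open>N[S]\<close> can terminate with the set \<open>P\<close>.
  The choices made in the loop do not matter, by \<open>PD_result_unique\<close>.\<close>

definition PD_result :: "('a, 'b) pre_digraph \<Rightarrow> 'a set \<Rightarrow> 'a set \<Rightarrow> bool" where
  "PD_result G S P \<longleftrightarrow>
     (pd_step G)\<^sup>*\<^sup>* (\<Union>v\<in>S. closed_nbhd G v) P \<and> \<not> (\<exists>Q. pd_step G P Q)"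

lemma pd_steps_subset_result:
  assumes "(pd_step G)\<^sup>*\<^sup>* P0 P" "P0 \<subseteq> Q" "\<not> (\<exists>R. pd_step G Q R)"
  shows "P \<subseteq> Q"
  using assms(1,2)
proof (induction rule: rtranclp_induct)
  case base
  then show ?case .
next
  case (step P P')
  then have sub: "P \<subseteq> Q" by blast
  from step.hyps(2) obtain v where v: "v \<in> P" "card (nbhd G v - P) = 1" "P' = P \<union> nbhd G v"
    by (cases rule: pd_step.cases) auto
  have fin: "finite (nbhd G v - P)" using v(2) by (metis card.infinite zero_neq_one)
  have "card (nbhd G v - Q) \<le> 1"
    using card_mono[OF fin, of "nbhd G v - Q"] sub v(2) by auto
  moreover have "card (nbhd G v - Q) \<noteq> 1"
    using assms(3) v(1) sub pd_step.intros[of v Q G] by blast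
  ultimately have "card (nbhd G v - Q) = 0" by linarith
  moreover have "finite (nbhd G v - Q)" using fin by (rule rev_finite_subset) (use sub in auto)
  ultimately have "nbhd G v \<subseteq> Q" by auto
  then show ?case using sub v(3) by auto
qed

lemma pd_steps_increasing: "(pd_step G)\<^sup>*\<^sup>* P Q \<Longrightarrow> P \<subseteq> Q"
  by (induction rule: rtranclp_induct) (auto elim: pd_step.cases)

lemma PD_result_unique:
  assumes "PD_result G S P" "PD_result G S Q"
  shows "P = Q"
  using assms pd_steps_subset_result pd_steps_increasing
  unfolding PD_result_def by (metis subset_antisym)

definition power_dominating :: "('a, 'b) pre_digraph \<Rightarrow> 'a set \<Rightarrow> bool" where
  "power_dominating G S \<longleftrightarrow> S \<subseteq> verts G \<and> PD_result G S (verts G)"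

definition gammaP :: "('a, 'b) pre_digraph \<Rightarrow> nat" where
  "gammaP G = Min (card ` {S. power_dominating G S})"

definition gammaP_containing :: "('a, 'b) pre_digraph \<Rightarrow> 'a set \<Rightarrow> nat" where
  "gammaP_containing G X = Min (card ` {S. power_dominating G S \<and> X \<subseteq> S})"

end

theory Submission
  imports Defs
begin

text \<open>
  A component of \<open>T - v\<close> contains exactly one neighbour of \<open>v\<close>, so the branches \<open>T\<^sub>i\<close> interact
  only through \<open>v\<close>. If \<open>S\<close> power dominates \<open>T\<close>, then \<open>(S \<inter> V\<^sub>i) \<union> {v}\<close> power dominates
  \<open>T\<^sub>i\<close>, whence \<open>|S| \<ge> g\<close>, and \<open>|S| \<ge> g + 1\<close> if \<open>v \<in> S\<close>. Suppose \<open>|S| = g\<close>. Then every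
  \<open>|S \<inter> V\<^sub>i|\<close> is one less than the optimum for \<open>T\<^sub>i\<close> with \<open>v\<close> prescribed. The vertex \<open>v\<close> is
  first observed from within some branch, and this branch has index in \<open>J\<close>. Moreover \<open>v\<close> forces at
  most one of its neighbours, so for all indices but one the set \<open>S \<inter> V\<^sub>i\<close> power dominates
  \<open>T\<^sub>i - v\<close>; hence \<open>|I| \<le> 1\<close>. Conversely, optimal sets of the branches can be glued: a branch
  from \<open>J\<close> observes \<open>v\<close>, then the branches outside \<open>I\<close> complete on their own, and finally \<open>v\<close>
  forces into the only branch from \<open>I\<close>.
\<close>

section \<open>Observation as a closure operator\<close>

text \<open>A least closed set stands in for the loop, so no order of steps has to be chosen. A bare
  neighbourhood function as parameter lets the same rules serve the tree, a branch, and a branch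
  without \<open>v\<close>.\<close>

inductive_set observed :: "('a \<Rightarrow> 'a set) \<Rightarrow> 'a set \<Rightarrow> 'a set" for N S where
  seed: "s \<in> S \<Longrightarrow> s \<in> observed N S"
| dominate: "s \<in> S \<Longrightarrow> w \<in> N s \<Longrightarrow> w \<in> observed N S"
| force: "x \<in> observed N S \<Longrightarrow> w \<in> N x \<Longrightarrow> (\<And>y. y \<in> N x \<Longrightarrow> y \<noteq> w \<Longrightarrow> y \<in> observed N S)
    \<Longrightarrow> w \<in> observed N S"

definition pd_sets :: "('a \<Rightarrow> 'a set) \<Rightarrow> 'a set \<Rightarrow> 'a set set" where
  "pd_sets N W = {S. S \<subseteq> W \<and> W \<subseteq> observed N S}"

definition pd_number :: "('a \<Rightarrow> 'a set) \<Rightarrow> 'a set \<Rightarrow> 'a set \<Rightarrow> nat" where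
  "pd_number N W X = Min (card ` {S \<in> pd_sets N W. X \<subseteq> S})"

text \<open>\<open>W\<close> itself is admissible, so the minimum is taken over a nonempty finite
  set.\<close>

lemma pd_number_props:
  assumes "finite W" "X \<subseteq> W"
  shows pd_number_attained: "\<exists>S \<in> pd_sets N W. X \<subseteq> S \<and> card S = pd_number N W X"
    and pd_number_le: "S \<in> pd_sets N W \<Longrightarrow> X \<subseteq> S \<Longrightarrow> pd_number N W X \<le> card S"
proof -
  have fin: "finite (card ` {S \<in> pd_sets N W. X \<subseteq> S})"
    using assms(1) by (auto simp: pd_sets_def intro: finite_subset[of _ "Pow W"])
  have "W \<in> {S \<in> pd_sets N W. X \<subseteq> S}"
    using assms(2) by (auto simp: pd_sets_def intro: observed.seed)
  then have "card ` {S \<in> pd_sets N W. X \<subseteq> S} \<noteq> {}" by blast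
  from Min_in[OF fin this]
  show "\<exists>S \<in> pd_sets N W. X \<subseteq> S \<and> card S = pd_number N W X"
    unfolding pd_number_def by (metis (mono_tags, lifting) imageE mem_Collect_eq)
  show "pd_number N W X \<le> card S" if "S \<in> pd_sets N W" "X \<subseteq> S"
    unfolding pd_number_def using fin that by (intro Min_le) auto
qed

lemma observed_subset_closed:
  assumes "S \<subseteq> P" "\<And>s. s \<in> S \<Longrightarrow> N s \<subseteq> P"
    "\<And>x w. x \<in> P \<Longrightarrow> w \<in> N x \<Longrightarrow> N x - {w} \<subseteq> P \<Longrightarrow> w \<in> P"
  shows "observed N S \<subseteq> P"
proof
  fix x assume "x \<in> observed N S"
  then show "x \<in> P" by (induction) (use assms in blast)+
qed

section \<open>The loop computes the closure\<close>

context fin_digraph begin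

lemma nbhd_subset_verts: "nbhd G x \<subseteq> verts G"
  by (auto simp: nbhd_def)

lemma pd_step_subset_verts: "P \<subseteq> verts G \<Longrightarrow> (pd_step G)\<^sup>*\<^sup>* P Q \<Longrightarrow> Q \<subseteq> verts G"
  by (rotate_tac, induction rule: rtranclp_induct)
    (use nbhd_subset_verts in \<open>auto elim!: pd_step.cases\<close>)

text \<open>Every step adds a vertex, so the number of vertices outside \<open>P\<close>
  drops.\<close>

lemma pd_steps_terminate:
  "P \<subseteq> verts G \<Longrightarrow> \<exists>Q. (pd_step G)\<^sup>*\<^sup>* P Q \<and> \<not> (\<exists>R. pd_step G Q R)"
proof (induction "card (verts G - P)" arbitrary: P rule: less_induct)
  case less
  show ?case
  proof (cases "\<exists>R. pd_step G P R")
    case True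
    then obtain R where R: "pd_step G P R" by blast
    then obtain x where x: "x \<in> P" "card (nbhd G x - P) = 1" "R = P \<union> nbhd G x"
      by (cases rule: pd_step.cases) auto
    then obtain w where "nbhd G x - P = {w}" by (metis card_1_singletonE)
    then have "w \<in> verts G - P" "w \<notin> verts G - R" "verts G - R \<subseteq> verts G - P"
      using nbhd_subset_verts x by blast+
    then have "card (verts G - R) < card (verts G - P)"
      by (intro psubset_card_mono) auto
    moreover have "R \<subseteq> verts G" using x less.prems nbhd_subset_verts by auto
    ultimately obtain Q where "(pd_step G)\<^sup>*\<^sup>* R Q" "\<not> (\<exists>R. pd_step G Q R)"
      using less.hyps by blast
    then show ?thesis using R by (meson converse_rtranclp_into_rtranclp)
  qed blast
qed

text \<open>A terminal set of the loop is the closure: every step is an instance of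
  \<open>force\<close>, and a set admitting no step is closed under forcing.\<close>

lemma power_dominating_iff:
  "power_dominating G S \<longleftrightarrow> S \<in> pd_sets (nbhd G) (verts G)"
proof (cases "S \<subseteq> verts G")
  case True
  let ?P = "\<Union>x\<in>S. closed_nbhd G x"
  have P: "?P \<subseteq> verts G"
    using True nbhd_subset_verts by (auto simp: closed_nbhd_def)
  then obtain Q where Q: "(pd_step G)\<^sup>*\<^sup>* ?P Q" "\<not> (\<exists>R. pd_step G Q R)"
    using pd_steps_terminate by blast
  have "Q \<subseteq> observed (nbhd G) S"
    using Q(1)
  proof (induction rule: rtranclp_induct)
    case base
    then show ?case by (auto simp: closed_nbhd_def intro: observed.intros)
  next
    case (step P P')
    from step.hyps(2) obtain x where x: "x \<in> P" "card (nbhd G x - P) = 1" "P' = P \<union> nbhd G x"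
      by (cases rule: pd_step.cases) auto
    then obtain w where w: "nbhd G x - P = {w}" by (metis card_1_singletonE)
    have "w \<in> observed (nbhd G) S"
      by (rule observed.force[of x]) (use w step.IH x(1) in auto)
    then show ?case using step.IH w x(3) by auto
  qed
  moreover have "observed (nbhd G) S \<subseteq> Q"
  proof (rule observed_subset_closed)
    have "?P \<subseteq> Q" using Q(1) by (rule pd_steps_increasing)
    then show "S \<subseteq> Q" "\<And>s. s \<in> S \<Longrightarrow> nbhd G s \<subseteq> Q" by (auto simp: closed_nbhd_def)
  next
    fix x w assume *: "x \<in> Q" "w \<in> nbhd G x" "nbhd G x - {w} \<subseteq> Q"
    show "w \<in> Q"
    proof (rule ccontr)
      assume "w \<notin> Q"
      then have "nbhd G x - Q = {w}" using * by auto
      then have "pd_step G Q (Q \<union> nbhd G x)" using * by (intro pd_step.intros) auto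
      then show False using Q(2) by blast
    qed
  qed
  ultimately have eq: "Q = observed (nbhd G) S" by blast
  have "PD_result G S Q" using Q by (simp add: PD_result_def)
  moreover have "Q \<subseteq> verts G" using P Q(1) pd_step_subset_verts by blast
  \<comment> \<open>By uniqueness \<open>Q\<close> is the only result of the loop.\<close>
  ultimately have "PD_result G S (verts G) \<longleftrightarrow> verts G \<subseteq> Q"
    using PD_result_unique by (metis subset_antisym order_refl)
  then show ?thesis using True eq by (simp add: power_dominating_def pd_sets_def)
qed (simp add: power_dominating_def pd_sets_def)

lemma gammaP_containing_eq: "gammaP_containing G X = pd_number (nbhd G) (verts G) X"
  by (simp add: gammaP_containing_def pd_number_def power_dominating_iff)

lemma gammaP_eq: "gammaP G = pd_number (nbhd G) (verts G) {}"
  by (simp add: gammaP_def pd_number_def power_dominating_iff)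

end

section \<open>Branches at a vertex\<close>

text \<open>The neighbourhood function of the induced subgraph; with the value \<open>{}\<close> off
  \<open>W\<close> the two agree as total functions.\<close>

definition restrict_nbhd :: "('a \<Rightarrow> 'a set) \<Rightarrow> 'a set \<Rightarrow> 'a \<Rightarrow> 'a set" where
  "restrict_nbhd N W x = (if x \<in> W then N x \<inter> W else {})"

text \<open>All that is kept of the tree: \<open>A i\<close> is the vertex set of a component of
  \<open>T - v\<close>, and \<open>u i\<close> is the only neighbour of \<open>v\<close> in
  it.\<close>

locale branches =
  fixes N :: "'a \<Rightarrow> 'a set" and v :: 'a and K :: "'i set" and A :: "'i \<Rightarrow> 'a set" and u :: "'i \<Rightarrow> 'a"
  assumes finite_K: "finite K"
    and finite_A: "i \<in> K \<Longrightarrow> finite (A i)"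
    and v_notin: "i \<in> K \<Longrightarrow> v \<notin> A i"
    and disj: "i \<in> K \<Longrightarrow> j \<in> K \<Longrightarrow> x \<in> A i \<Longrightarrow> x \<in> A j \<Longrightarrow> i = j"
    and u_in: "i \<in> K \<Longrightarrow> u i \<in> A i"
    and N_v: "N v = u ` K"
    and N_A: "i \<in> K \<Longrightarrow> x \<in> A i \<Longrightarrow> N x \<subseteq> insert v (A i)"
    and v_in_N: "i \<in> K \<Longrightarrow> x \<in> A i \<Longrightarrow> v \<in> N x \<longleftrightarrow> x = u i"
begin

text \<open>\<open>W\<close> is the vertex set of \<open>T\<close>; \<open>B i\<close> and
  \<open>M i\<close> are the neighbourhood functions of \<open>T\<^sub>i\<close> and
  \<open>T\<^sub>i - v\<close>.\<close>

abbreviation "W \<equiv> insert v (\<Union>i\<in>K. A i)"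
abbreviation "B i \<equiv> restrict_nbhd N (insert v (A i))"
abbreviation "M i \<equiv> restrict_nbhd N (A i)"

lemma finite_W: "finite W"
  using finite_K finite_A by auto

lemma B_v: "i \<in> K \<Longrightarrow> B i v = {u i}"
  using N_v u_in v_notin disj by (fastforce simp: restrict_nbhd_def)

lemma B_A: "i \<in> K \<Longrightarrow> x \<in> A i \<Longrightarrow> B i x = N x"
  using N_A by (auto simp: restrict_nbhd_def)

lemma M_A: "i \<in> K \<Longrightarrow> x \<in> A i \<Longrightarrow> M i x = N x - {v}"
  using N_A v_notin by (fastforce simp: restrict_nbhd_def)

text \<open>The case split of the restriction arguments: from outside, \<open>A i\<close> can be
  entered only along the edge from \<open>v\<close> to \<open>u i\<close>.\<close>

lemma N_into_A:
  assumes "i \<in> K" "x \<in> W" "w \<in> N x" "w \<in> A i"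
  shows "x \<in> A i \<or> x = v \<and> w = u i"
proof (cases "x = v")
  case True
  then obtain j where j: "j \<in> K" "w = u j" using assms(3) N_v by auto
  then have "i = j" using disj[OF assms(1) j(1) assms(4)] u_in[OF j(1)] by simp
  then show ?thesis using True j by simp
next
  case False
  then obtain j where j: "j \<in> K" "x \<in> A j" using assms(2) by auto
  then have "w \<in> A j" using N_A[OF j] assms(3,4) v_notin[OF assms(1)] by auto
  then show ?thesis using disj[OF assms(1) j(1) assms(4)] j(2) by simp
qed

lemma N_subset_W: "x \<in> W \<Longrightarrow> N x \<subseteq> W"
proof (cases "x = v")
  case True
  then show ?thesis using N_v u_in by fastforce
next
  case False
  assume "x \<in> W"
  then obtain i where "i \<in> K" "x \<in> A i" using False by auto
  then show ?thesis using N_A[of i x] by blast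
qed

lemma observed_subset_W:
  assumes "S \<subseteq> W"
  shows "observed N S \<subseteq> W"
proof (rule observed_subset_closed[OF assms])
  show "\<And>s. s \<in> S \<Longrightarrow> N s \<subseteq> W" using assms N_subset_W by blast
  show "\<And>x w. x \<in> W \<Longrightarrow> w \<in> N x \<Longrightarrow> w \<in> W" using N_subset_W by blast
qed

section \<open>From the tree to a branch\<close>

text \<open>With \<open>v\<close> in the set, \<open>v\<close> and \<open>u i\<close> are observed
  at once. Any other vertex of \<open>A i\<close> is observed through a vertex of
  \<open>A i\<close>, which has the same neighbours in the branch as in the tree.\<close>

lemma observed_restrict_insert:
  assumes i: "i \<in> K" and S: "S \<subseteq> W"
  shows "observed N S \<inter> insert v (A i) \<subseteq> observed (B i) (insert v (S \<inter> A i))" (is "_ \<subseteq> ?O")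
proof -
  have v: "v \<in> ?O" and u: "u i \<in> ?O"
    using B_v[OF i] by (auto intro: observed.intros)
  have "x \<in> A i \<longrightarrow> x \<in> ?O" if "x \<in> observed N S" for x
    using that
  proof (induction)
    case (seed s)
    then show ?case by (auto intro: observed.seed)
  next
    case (dominate s w)
    show ?case
    proof
      assume w: "w \<in> A i"
      then consider "s \<in> A i" | "w = u i" using dominate S N_into_A[OF i] by blast
      then show "w \<in> ?O"
        using u dominate B_A[OF i] by cases (auto intro: observed.dominate[of s])
    qed
  next
    case (force x w)
    show ?case
    proof
      assume w: "w \<in> A i"
      have "x \<in> W" using force.hyps(1) observed_subset_W[OF S] by blast
      then consider "x \<in> A i" | "w = u i" using force.hyps w N_into_A[OF i] by blast
      then show "w \<in> ?O"
      proof cases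
        case 1
        show ?thesis
          by (rule observed.force[of x]) (use 1 force v B_A[OF i 1] N_A[OF i 1] in auto)
      qed (use u in simp)
    qed
  qed
  then show ?thesis using v by blast
qed

text \<open>The hypothesis \<open>stuck\<close> says that \<open>v\<close> cannot force into a branch from \<open>L\<close> unless that neighbour
  is observed anyway. It is used for \<open>L\<close> with one element, whose neighbour of \<open>v\<close> is observed within
  the branch, and with two elements, where neither is.\<close>

lemma observed_restrict_delete:
  assumes S: "S \<subseteq> W" "v \<notin> S" and L: "L \<subseteq> K"
    and stuck: "\<And>l. l \<in> L \<Longrightarrow> (\<And>j. j \<in> L \<Longrightarrow> j \<noteq> l \<Longrightarrow> u j \<in> observed (M j) (S \<inter> A j))
      \<Longrightarrow> u l \<in> observed (M l) (S \<inter> A l)"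
    and l: "l \<in> L"
  shows "observed N S \<inter> A l \<subseteq> observed (M l) (S \<inter> A l)"
proof -
  have "\<forall>l\<in>L. x \<in> A l \<longrightarrow> x \<in> observed (M l) (S \<inter> A l)" if "x \<in> observed N S" for x
    using that
  proof (induction)
    case (seed s)
    then show ?case by (auto intro: observed.seed)
  next
    case (dominate s w)
    show ?case
    proof (intro ballI impI)
      fix l assume l: "l \<in> L" "w \<in> A l"
      then have K: "l \<in> K" using L by blast
      have "s \<in> A l" using l dominate S N_into_A[OF K] by blast
      then show "w \<in> observed (M l) (S \<inter> A l)"
        using dominate l M_A[OF K] v_notin[OF K] by (auto intro!: observed.dominate[of s])
    qed
  next
    case (force x w)
    show ?case
    proof (intro ballI impI)
      fix l assume l: "l \<in> L" "w \<in> A l"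
      then have K: "l \<in> K" using L by blast
      have "x \<in> W" using force.hyps(1) observed_subset_W[OF S(1)] by blast
      then consider "x \<in> A l" | "x = v" "w = u l" using force.hyps l N_into_A[OF K] by blast
      then show "w \<in> observed (M l) (S \<inter> A l)"
      proof cases
        case 1
        show ?thesis
        proof (rule observed.force[of x])
          show "x \<in> observed (M l) (S \<inter> A l)" using force.IH(1) 1 l by auto
          show "w \<in> M l x" using force.hyps(2) l M_A[OF K 1] v_notin[OF K] by auto
          fix y assume y: "y \<in> M l x" "y \<noteq> w"
          then have "y \<in> A l" "y \<in> N x" using M_A[OF K 1] N_A[OF K 1] by auto
          then show "y \<in> observed (M l) (S \<inter> A l)" using force.IH(2) y l by auto
        qed
      next
        case 2
        \<comment> \<open>When \<open>v\<close> forces \<open>u l\<close>, its other neighbours are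
          already observed; by induction those in \<open>L\<close> are observed within their own
          branches, which is the premise of \<open>stuck\<close>.\<close>
        have "u j \<in> observed (M j) (S \<inter> A j)" if j: "j \<in> L" "j \<noteq> l" for j
        proof -
          have jK: "j \<in> K" using j L by blast
          then have "u j \<noteq> u l" using j K u_in disj by metis
          then show ?thesis using force.IH(2)[of "u j"] 2 N_v j jK u_in by auto
        qed
        then show ?thesis using stuck l 2 by blast
      qed
    qed
  qed
  then show ?thesis using l by blast
qed

text \<open>Until \<open>v\<close> is observed nothing passes between branches. So if no branch
  observes \<open>v\<close> by itself, an induction shows that each branch evolves alone and
  \<open>v\<close> is never reached.\<close>

lemma v_observed_from_branch:
  assumes S: "S \<subseteq> W" "v \<notin> S" and v: "v \<in> observed N S"
  shows "\<exists>i\<in>K. v \<in> observed (B i) (S \<inter> A i)"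
proof (rule ccontr)
  assume neg: "\<not> ?thesis"
  have "x \<noteq> v \<and> (\<forall>i\<in>K. x \<in> A i \<longrightarrow> x \<in> observed (B i) (S \<inter> A i))"
    if "x \<in> observed N S" for x
    using that
  proof (induction)
    case (seed s)
    then show ?case using S by (auto intro: observed.seed)
  next
    case (dominate s w)
    then obtain i where i: "i \<in> K" "s \<in> A i" using S by auto
    then have "w \<in> observed (B i) (S \<inter> A i)"
      using dominate B_A[OF i] by (auto intro: observed.dominate[of s])
    then show ?case using neg i N_A[OF i] dominate disj by blast
  next
    case (force x w)
    then obtain i where i: "i \<in> K" "x \<in> A i" using observed_subset_W[OF S(1)] by blast
    have "w \<in> observed (B i) (S \<inter> A i)"
    proof (rule observed.force[of x])
      fix y assume "y \<in> B i x" "y \<noteq> w"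
      then show "y \<in> observed (B i) (S \<inter> A i)"
        using force.IH(2)[of y] i B_A[OF i] N_A[OF i] by auto
    qed (use force i B_A[OF i] in auto)
    then show ?case using neg i N_A[OF i] force.hyps(2) disj by blast
  qed
  then show False using v by blast
qed

text \<open>In the branch only \<open>u i\<close> has \<open>v\<close> as a neighbour, so
  \<open>u i\<close> must have dominated or forced \<open>v\<close>.\<close>

lemma u_observed_if_v_observed:
  assumes i: "i \<in> K" and S: "S \<subseteq> A i" and v: "v \<in> observed (B i) S"
  shows "u i \<in> observed (B i) S"
proof -
  have sub: "observed (B i) S \<subseteq> insert v (A i)"
    by (rule observed_subset_closed) (use S in \<open>auto simp: restrict_nbhd_def split: if_splits\<close>)
  have eq: "x = u i" if "x \<in> insert v (A i)" "v \<in> B i x" for x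
    using that i B_v B_A v_in_N u_in v_notin by (cases "x = v") auto
  show ?thesis
    using v
  proof cases
    case seed
    then show ?thesis using S v_notin[OF i] by blast
  next
    case (dominate s)
    then show ?thesis using eq[of s] S by (auto intro: observed.seed)
  next
    case (force x)
    then show ?thesis using eq[of x] sub by auto
  qed
qed

text \<open>If \<open>S\<close> observes \<open>v\<close>, it also observes the only vertex that
  \<open>v\<close> could dominate, so adding \<open>v\<close> to \<open>S\<close> gains
  nothing.\<close>

lemma pd_set_if_v_observed:
  assumes i: "i \<in> K" and S: "S \<subseteq> A i" and v: "v \<in> observed (B i) S"
    and pd: "insert v S \<in> pd_sets (B i) (insert v (A i))"
  shows "S \<in> pd_sets (B i) (insert v (A i))"
proof -
  have "observed (B i) (insert v S) \<subseteq> observed (B i) S"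
  proof (rule observed_subset_closed)
    show "insert v S \<subseteq> observed (B i) S" using v by (auto intro: observed.seed)
    show "\<And>s. s \<in> insert v S \<Longrightarrow> B i s \<subseteq> observed (B i) S"
      using u_observed_if_v_observed[OF i S v] B_v[OF i] by (auto intro: observed.dominate)
    show "\<And>x w. x \<in> observed (B i) S \<Longrightarrow> w \<in> B i x \<Longrightarrow> B i x - {w} \<subseteq> observed (B i) S
      \<Longrightarrow> w \<in> observed (B i) S"
      by (rule observed.force) auto
  qed
  then show ?thesis using pd S by (auto simp: pd_sets_def)
qed

section \<open>From a branch to the tree\<close>

text \<open>In the tree \<open>v\<close> may have further neighbours, so its forcing of
  \<open>u i\<close> in the branch need not carry over; hence \<open>u i\<close> is assumed to be
  observed.\<close>

lemma observed_extend_insert: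
  assumes i: "i \<in> K" and R: "R \<inter> A i \<subseteq> S"
    and v: "v \<in> observed N S" and u: "u i \<in> observed N S"
    and R': "R \<subseteq> insert v (A i)"
  shows "observed (B i) R \<subseteq> observed N S"
proof -
  have "x \<in> insert v (A i) \<and> x \<in> observed N S" if "x \<in> observed (B i) R" for x
    using that
  proof (induction)
    case (seed s)
    then show ?case using R R' v by (auto intro: observed.seed)
  next
    case (dominate s w)
    show ?case
    proof (cases "s = v")
      case True
      then show ?thesis using dominate B_v[OF i] u u_in[OF i] by auto
    next
      case False
      then have s: "s \<in> A i" "s \<in> S" using dominate R R' by auto
      then show ?thesis using dominate B_A[OF i s(1)] N_A[OF i s(1)]
        by (auto intro: observed.dominate[of s])
    qed
  next
    case (force x w)
    show ?case
    proof (cases "x = v")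
      case True
      then show ?thesis using force B_v[OF i] u u_in[OF i] by auto
    next
      case False
      then have x: "x \<in> A i" using force by auto
      have "w \<in> observed N S"
        by (rule observed.force[of x]) (use x force B_A[OF i x] in auto)
      then show ?thesis using force.hyps(2) B_A[OF i x] N_A[OF i x] by auto
    qed
  qed
  then show ?thesis by blast
qed

lemma observed_extend_branch:
  assumes i: "i \<in> K" and R: "R \<subseteq> A i" "R \<subseteq> S"
  shows "observed (B i) R \<subseteq> observed N S"
proof -
  \<comment> \<open>The last conjunct handles forcing by \<open>v\<close>: its only target in the
    branch is \<open>u i\<close>, which was observed before \<open>v\<close>.\<close>
  have "x \<in> insert v (A i) \<and> x \<in> observed N S \<and> (x = v \<longrightarrow> u i \<in> observed N S)"
    if "x \<in> observed (B i) R" for x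
    using that
  proof (induction)
    case (seed s)
    then show ?case using R v_notin[OF i] by (auto intro: observed.seed)
  next
    case (dominate s w)
    then have s: "s \<in> A i" "s \<in> S" using R by auto
    then show ?case using dominate B_A[OF i s(1)] N_A[OF i s(1)] v_in_N[OF i s(1)]
      by (auto intro: observed.dominate[of s] observed.seed)
  next
    case (force x w)
    show ?case
    proof (cases "x = v")
      case True
      then show ?thesis using force B_v[OF i] u_in[OF i] v_notin[OF i] by auto
    next
      case False
      then have x: "x \<in> A i" using force by auto
      have "w \<in> observed N S"
        by (rule observed.force[of x]) (use x force B_A[OF i x] in auto)
      then show ?thesis using force B_A[OF i x] N_A[OF i x] v_in_N[OF i x] by auto
    qed
  qed
  then show ?thesis by blast
qed

text \<open>In the tree \<open>u i\<close> has the extra neighbour \<open>v\<close>; as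
  \<open>v\<close> is observed, this blocks no forcing by \<open>u i\<close>.\<close>

lemma observed_extend_delete:
  assumes i: "i \<in> K" and R: "R \<subseteq> A i" "R \<subseteq> S" and v: "v \<in> observed N S"
  shows "observed (M i) R \<subseteq> observed N S"
proof -
  have "x \<in> A i \<and> x \<in> observed N S" if "x \<in> observed (M i) R" for x
    using that
  proof (induction)
    case (seed s)
    then show ?case using R by (auto intro: observed.seed)
  next
    case (dominate s w)
    then have s: "s \<in> A i" "s \<in> S" using R by auto
    then show ?case using dominate M_A[OF i s(1)] N_A[OF i s(1)]
      by (auto intro: observed.dominate[of s])
  next
    case (force x w)
    then have x: "x \<in> A i" by auto
    have "w \<in> observed N S"
      by (rule observed.force[of x]) (use force v M_A[OF i x] in auto)
    then show ?case using force.hyps(2) M_A[OF i x] N_A[OF i x] by auto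
  qed
  then show ?thesis by blast
qed

text \<open>\<open>a i\<close>, \<open>b i\<close> and \<open>c i\<close> correspond to \<open>\<gamma>\<^sub>P(T\<^sub>i;{v})\<close>, \<open>\<gamma>\<^sub>P(T\<^sub>i)\<close> and \<open>\<gamma>\<^sub>P(T\<^sub>i - v)\<close>.\<close>

abbreviation "a i \<equiv> pd_number (B i) (insert v (A i)) {v}"
abbreviation "b i \<equiv> pd_number (B i) (insert v (A i)) {}"
abbreviation "c i \<equiv> pd_number (M i) (A i) {}"

section \<open>Relations between the branch numbers\<close>

lemma card_insert_v: "i \<in> K \<Longrightarrow> S \<subseteq> A i \<Longrightarrow> card (insert v S) = Suc (card S)"
  using finite_A[of i] v_notin[of i] by (meson card_insert_disjoint finite_subset subsetD)

lemma a_le_if_pd_insert: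
  assumes i: "i \<in> K" and S: "S \<subseteq> A i" "insert v S \<in> pd_sets (B i) (insert v (A i))"
  shows "a i \<le> Suc (card S)"
  using pd_number_le[of "insert v (A i)" "{v}" "insert v S" "B i"] assms finite_A[OF i]
    card_insert_v[OF i S(1)] by simp

lemma a_attained:
  assumes i: "i \<in> K"
  obtains S where "S \<subseteq> A i" "insert v S \<in> pd_sets (B i) (insert v (A i))" "a i = Suc (card S)"
proof -
  obtain R where R: "R \<in> pd_sets (B i) (insert v (A i))" "v \<in> R" "card R = a i"
    using pd_number_attained[of "insert v (A i)" "{v}" "B i"] finite_A[OF i] by auto
  then have "R - {v} \<subseteq> A i" "insert v (R - {v}) = R" by (auto simp: pd_sets_def)
  then show ?thesis using that[of "R - {v}"] R card_insert_v[OF i, of "R - {v}"] by simp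
qed

lemma a_le_Suc_b:
  assumes i: "i \<in> K"
  shows "a i \<le> Suc (b i)"
proof -
  have fin: "finite (insert v (A i))" using finite_A[OF i] by simp
  obtain R where R: "R \<in> pd_sets (B i) (insert v (A i))" "card R = b i"
    using pd_number_attained[OF fin, of "{}" "B i"] by auto
  have "observed (B i) R \<subseteq> observed (B i) (insert v R)"
    by (rule observed_subset_closed) (auto intro: observed.intros)
  then have "insert v R \<in> pd_sets (B i) (insert v (A i))" using R by (auto simp: pd_sets_def)
  then have "a i \<le> card (insert v R)"
    using pd_number_le[OF fin, of "{v}" "insert v R" "B i"] by simp
  also have "\<dots> \<le> Suc (b i)" using R card_insert_le_m1
    by (metis card_insert_if card.infinite finite_insert le_SucI order_refl)
  finally show ?thesis .
qed

lemma b_le_a: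
  assumes i: "i \<in> K"
  shows "b i \<le> a i"
proof -
  have fin: "finite (insert v (A i))" using finite_A[OF i] by simp
  show ?thesis
    using pd_number_attained[OF fin, of "{v}" "B i"] pd_number_le[OF fin, of "{}" _ "B i"] by force
qed

text \<open>Adding \<open>v\<close> to an optimal set of \<open>T\<^sub>i - v\<close> removes the
  obstruction that \<open>v\<close> is an extra neighbour of \<open>u i\<close>.\<close>

lemma a_le_Suc_c:
  assumes i: "i \<in> K"
  shows "a i \<le> Suc (c i)"
proof -
  obtain R where R: "R \<in> pd_sets (M i) (A i)" "card R = c i"
    using pd_number_attained[OF finite_A[OF i], of "{}" "M i"] by auto
  let ?O = "observed (B i) (insert v R)"
  have v: "v \<in> ?O" by (auto intro: observed.seed)
  have RA: "R \<subseteq> A i" using R by (auto simp: pd_sets_def)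
  have "x \<in> A i \<and> x \<in> ?O" if "x \<in> observed (M i) R" for x
    using that
  proof (induction)
    case (seed s)
    then show ?case using RA by (auto intro: observed.seed)
  next
    case (dominate s w)
    then have s: "s \<in> A i" using RA by auto
    then show ?case using dominate M_A[OF i s] B_A[OF i s] N_A[OF i s]
      by (auto intro: observed.dominate[of s])
  next
    case (force x w)
    then have x: "x \<in> A i" by auto
    have "w \<in> ?O"
      by (rule observed.force[of x]) (use force v M_A[OF i x] B_A[OF i x] in auto)
    then show ?case using force.hyps(2) M_A[OF i x] N_A[OF i x] by auto
  qed
  then have "insert v R \<in> pd_sets (B i) (insert v (A i))"
    using R v by (auto simp: pd_sets_def)
  from a_le_if_pd_insert[OF i RA this] show ?thesis using R by simp
qed

section \<open>Lower bound and gluing\<close>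

lemma card_S_eq:
  assumes "S \<subseteq> W" "v \<notin> S"
  shows "card S = (\<Sum>i\<in>K. card (S \<inter> A i))"
proof -
  have "S = (\<Union>i\<in>K. S \<inter> A i)" using assms by auto
  then have "card S = card (\<Union>i\<in>K. S \<inter> A i)" by simp
  also have "\<dots> = (\<Sum>i\<in>K. card (S \<inter> A i))"
    using finite_K finite_A disj by (intro card_UN_disjoint) auto
  finally show ?thesis .
qed

lemma branch_lower_bound:
  assumes "S \<in> pd_sets N W" "i \<in> K"
  shows "insert v (S \<inter> A i) \<in> pd_sets (B i) (insert v (A i))"
    and "a i \<le> Suc (card (S \<inter> A i))"
proof -
  have S: "S \<subseteq> W" "W \<subseteq> observed N S" using assms(1) by (auto simp: pd_sets_def)
  show *: "insert v (S \<inter> A i) \<in> pd_sets (B i) (insert v (A i))"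
    using observed_restrict_insert[OF assms(2) S(1)] S(2) assms(2) by (auto simp: pd_sets_def)
  show "a i \<le> Suc (card (S \<inter> A i))"
    by (rule a_le_if_pd_insert[OF assms(2) _ *]) simp
qed

text \<open>The number \<open>g\<close> as a natural number. Sets counted by \<open>a i\<close>
  contain \<open>v\<close>, so \<open>a i\<close> is positive and the truncated subtraction is
  exact.\<close>

definition branch_sum :: nat where
  "branch_sum = (\<Sum>i\<in>K. a i - 1)"

text \<open>Optimal sets with \<open>v\<close> prescribed are glued along their common element
  \<open>v\<close>, which then dominates every \<open>u i\<close>.\<close>

lemma pd_number_le_Suc_branch_sum: "pd_number N W {} \<le> Suc branch_sum"
proof -
  have "\<exists>S. \<forall>i\<in>K. S i \<subseteq> A i \<and> insert v (S i) \<in> pd_sets (B i) (insert v (A i)) \<and> a i = Suc (card (S i))"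
    using a_attained by (intro bchoice) metis
  then obtain S where S: "\<And>i. i \<in> K \<Longrightarrow> S i \<subseteq> A i"
    "\<And>i. i \<in> K \<Longrightarrow> insert v (S i) \<in> pd_sets (B i) (insert v (A i))"
    "\<And>i. i \<in> K \<Longrightarrow> a i = Suc (card (S i))" by blast
  let ?R = "\<Union>i\<in>K. S i"
  have v: "v \<in> observed N (insert v ?R)" by (auto intro: observed.seed)
  have "insert v (A i) \<subseteq> observed N (insert v ?R)" if i: "i \<in> K" for i
  proof -
    have "u i \<in> observed N (insert v ?R)" using i N_v by (auto intro: observed.dominate[of v])
    then have "observed (B i) (insert v (S i)) \<subseteq> observed N (insert v ?R)"
      using i S(1)[OF i] v by (intro observed_extend_insert[OF i]) auto
    then show ?thesis using S(2)[OF i] by (auto simp: pd_sets_def)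
  qed
  then have "W \<subseteq> observed N (insert v ?R)" using v by blast
  moreover have "insert v ?R \<subseteq> W" using S(1) by blast
  ultimately have "insert v ?R \<in> pd_sets N W" by (simp only: pd_sets_def mem_Collect_eq simp_thms)
  then have "pd_number N W {} \<le> card (insert v ?R)" using pd_number_le finite_W by blast
  also have "\<dots> \<le> Suc (card ?R)" by (simp add: card_insert_le_m1)
  also have "card ?R \<le> (\<Sum>i\<in>K. card (S i))" using finite_K by (rule card_UN_le)
  also have "\<dots> = branch_sum" unfolding branch_sum_def using S(3) by (intro sum.cong) auto
  finally show ?thesis by simp
qed

lemma pd_number_le_branch_sum:
  assumes I: "card {i \<in> K. a i = b i \<and> 1 + c i \<noteq> a i} \<le> 1" and J: "{i \<in> K. a i \<noteq> b i} \<noteq> {}"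
  shows "pd_number N W {} \<le> branch_sum"
proof -
  define I where "I = {i \<in> K. a i = b i \<and> 1 + c i \<noteq> a i}"
  have I_sub: "i = j" if "i \<in> I" "j \<in> I" for i j
  proof -
    have "finite I" using finite_K by (simp add: I_def)
    then show ?thesis using I that unfolding I_def[symmetric]
      by (metis card_le_Suc0_iff_eq One_nat_def)
  qed
  \<comment> \<open>In each of the three classes of indices there is a set of \<open>a i - 1\<close>
    vertices avoiding \<open>v\<close>; the classes differ in how much help from \<open>v\<close> it
    needs.\<close>
  define good where "good i S \<longleftrightarrow> S \<subseteq> A i \<and> a i = Suc (card S) \<and>
      (if i \<in> I then insert v S \<in> pd_sets (B i) (insert v (A i))
       else if a i = b i then S \<in> pd_sets (M i) (A i)
       else S \<in> pd_sets (B i) (insert v (A i)))" for i S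
  have "\<exists>S. good i S" if i: "i \<in> K" for i
  proof -
    have fin: "finite (insert v (A i))" using finite_A[OF i] by simp
    consider "i \<in> I" | "i \<notin> I" "a i = b i" "1 + c i = a i" | "i \<notin> I" "a i \<noteq> b i"
      using i unfolding I_def by blast
    then show ?thesis
    proof cases
      case 1
      then show ?thesis using a_attained[OF i] unfolding good_def by metis
    next
      case 2
      obtain S where "S \<in> pd_sets (M i) (A i)" "card S = c i"
        using pd_number_attained[OF finite_A[OF i], of "{}" "M i"] by auto
      then show ?thesis using 2 by (intro exI[of _ S]) (auto simp: good_def pd_sets_def)
    next
      case 3
      then have ab: "a i = Suc (b i)" using a_le_Suc_b[OF i] b_le_a[OF i] by linarith
      obtain S where S: "S \<in> pd_sets (B i) (insert v (A i))" "card S = b i"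
        using pd_number_attained[OF fin, of "{}" "B i"] by auto
      \<comment> \<open>An optimal set containing \<open>v\<close> would give \<open>a i\<close> at
        most \<open>b i\<close>.\<close>
      have "v \<notin> S"
        using pd_number_le[OF fin, of "{v}" S "B i"] S ab by auto
      then show ?thesis using 3 S ab by (intro exI[of _ S]) (auto simp: good_def pd_sets_def)
    qed
  qed
  then obtain S where good: "\<And>i. i \<in> K \<Longrightarrow> good i (S i)" by metis
  then have S: "\<And>i. i \<in> K \<Longrightarrow> S i \<subseteq> A i"
    "\<And>i. i \<in> K \<Longrightarrow> a i = Suc (card (S i))"
    and SI: "\<And>i. i \<in> K \<Longrightarrow> i \<in> I \<Longrightarrow> insert v (S i) \<in> pd_sets (B i) (insert v (A i))"
    and SI': "\<And>i. i \<in> K \<Longrightarrow> i \<notin> I \<Longrightarrow> a i = b i \<Longrightarrow> S i \<in> pd_sets (M i) (A i)"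
    and SJ: "\<And>i. i \<in> K \<Longrightarrow> i \<notin> I \<Longrightarrow> a i \<noteq> b i \<Longrightarrow> S i \<in> pd_sets (B i) (insert v (A i))"
    by (simp_all add: good_def)
  let ?R = "\<Union>i\<in>K. S i"
  have obsJ: "insert v (A i) \<subseteq> observed N ?R" if i: "i \<in> K" "a i \<noteq> b i" for i
  proof -
    have "S i \<in> pd_sets (B i) (insert v (A i))" using SJ[OF i(1)] i by (auto simp: I_def)
    then show ?thesis
      using observed_extend_branch[OF i(1), of "S i" ?R] S(1)[OF i(1)] i(1) by (auto simp: pd_sets_def)
  qed
  then have v: "v \<in> observed N ?R" using J by auto
  have notI: "A i \<subseteq> observed N ?R" if i: "i \<in> K" "i \<notin> I" for i
  proof (cases "a i = b i")
    case True
    then show ?thesis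
      using SI'[OF i] observed_extend_delete[OF i(1), of "S i" ?R] v S(1)[OF i(1)] i(1)
      by (auto simp: pd_sets_def)
  qed (use obsJ i in auto)
  have "A i \<subseteq> observed N ?R" if i: "i \<in> K" "i \<in> I" for i
  proof -
    have "u i \<in> observed N ?R"
    proof (rule observed.force[OF v])
      show "u i \<in> N v" using i N_v by auto
      fix y assume "y \<in> N v" "y \<noteq> u i"
      then obtain j where j: "j \<in> K" "y = u j" "j \<noteq> i" using N_v by auto
      \<comment> \<open>\<open>i\<close> is the only index in \<open>I\<close>, so every other
        neighbour of \<open>v\<close> lies in a branch that is already observed.\<close>
      then show "y \<in> observed N ?R" using notI[of j] I_sub[of i j] i u_in by blast
    qed
    then have "observed (B i) (insert v (S i)) \<subseteq> observed N ?R"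
      using i S(1)[OF i(1)] v v_notin[OF i(1)] by (intro observed_extend_insert[OF i(1)]) auto
    then show ?thesis using SI[OF i] by (auto simp: pd_sets_def)
  qed
  then have "W \<subseteq> observed N ?R" using v notI by blast
  moreover have "?R \<subseteq> W" using S(1) by blast
  ultimately have "?R \<in> pd_sets N W" by (simp only: pd_sets_def mem_Collect_eq simp_thms)
  then have "pd_number N W {} \<le> card ?R" using pd_number_le finite_W by blast
  also have "card ?R \<le> (\<Sum>i\<in>K. card (S i))" using finite_K by (rule card_UN_le)
  also have "\<dots> = branch_sum" unfolding branch_sum_def using S(2) by (intro sum.cong) auto
  finally show ?thesis .
qed

text \<open>Each branch contributes at least \<open>a i - 1\<close> vertices other than
  \<open>v\<close>; equality in the sum makes every branch tight and excludes \<open>v\<close> from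
  \<open>S\<close>.\<close>

lemma pd_set_bound:
  assumes S: "S \<in> pd_sets N W"
  shows "branch_sum \<le> card S"
    and "card S = branch_sum \<Longrightarrow>
      card {i \<in> K. a i = b i \<and> 1 + c i \<noteq> a i} \<le> 1 \<and> {i \<in> K. a i \<noteq> b i} \<noteq> {}"
proof -
  have S': "S \<subseteq> W" "W \<subseteq> observed N S" using S by (auto simp: pd_sets_def)
  have le: "a i - 1 \<le> card (S \<inter> A i)" if "i \<in> K" for i
    using branch_lower_bound(2)[OF S that] by simp
  have card: "card (S - {v}) = (\<Sum>i\<in>K. card (S \<inter> A i))"
  proof -
    have "(S - {v}) \<inter> A i = S \<inter> A i" if "i \<in> K" for i using v_notin[OF that] by auto
    moreover have "S - {v} \<subseteq> W" using S' by auto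
    ultimately show ?thesis using card_S_eq[of "S - {v}"] by simp
  qed
  have ge: "branch_sum \<le> card (S - {v})"
    unfolding card branch_sum_def using le by (rule sum_mono)
  have finS: "finite S" using S'(1) finite_W by (rule finite_subset)
  then show "branch_sum \<le> card S" using ge by (meson card_Diff1_le order_trans)
  show "card {i \<in> K. a i = b i \<and> 1 + c i \<noteq> a i} \<le> 1 \<and> {i \<in> K. a i \<noteq> b i} \<noteq> {}"
    if eq: "card S = branch_sum"
  proof
    have v: "v \<notin> S"
      using ge eq finS card_Diff1_less[of S v] by linarith
    have sums: "(\<Sum>i\<in>K. card (S \<inter> A i)) = (\<Sum>i\<in>K. a i - 1)"
      using card v eq by (simp add: branch_sum_def)
    have eqi: "card (S \<inter> A i) = a i - 1" if "i \<in> K" for i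
      using sum_mono_inv[OF sums[symmetric] le that finite_K] by simp
    have pos: "1 \<le> a i" if "i \<in> K" for i
      using a_attained[OF that] by (metis le_add1 plus_1_eq_Suc)
    obtain i where i: "i \<in> K" "v \<in> observed (B i) (S \<inter> A i)"
      using v_observed_from_branch[OF S'(1) v] S'(2) by auto
    have "S \<inter> A i \<in> pd_sets (B i) (insert v (A i))"
      using pd_set_if_v_observed[OF i(1) _ i(2) branch_lower_bound(1)[OF S i(1)]] by simp
    then have "b i \<le> card (S \<inter> A i)"
      using pd_number_le[of "insert v (A i)" "{}" _ "B i"] finite_A[OF i(1)] by simp
    \<comment> \<open>The branch that observes \<open>v\<close> is power dominated by only
      \<open>a i - 1\<close> vertices.\<close>
    then have "a i \<noteq> b i" using eqi[OF i(1)] pos[OF i(1)] by linarith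
    then show "{i \<in> K. a i \<noteq> b i} \<noteq> {}" using i by blast
    have c: "1 + c i = a i" if i: "i \<in> K" and u: "u i \<in> observed (M i) (S \<inter> A i)" for i
    proof -
      \<comment> \<open>With \<open>L = {i}\<close> the conclusion of \<open>stuck\<close> is the
        assumption on \<open>u i\<close>.\<close>
      have "A i \<subseteq> observed (M i) (S \<inter> A i)"
        using observed_restrict_delete[OF S'(1) v, of "{i}" i] i u S'(2) by auto
      then have "S \<inter> A i \<in> pd_sets (M i) (A i)" by (auto simp: pd_sets_def)
      then have "c i \<le> card (S \<inter> A i)"
        using pd_number_le[OF finite_A[OF i], of "{}" _ "M i"] by simp
      then show ?thesis using eqi[OF i] pos[OF i] a_le_Suc_c[OF i] by linarith
    qed
    have "i = j" if ij: "i \<in> K" "1 + c i \<noteq> a i" "j \<in> K" "1 + c j \<noteq> a j" for i j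
    proof (rule ccontr)
      assume ne: "i \<noteq> j"
      have nu: "u i \<notin> observed (M i) (S \<inter> A i)" "u j \<notin> observed (M j) (S \<inter> A j)"
        using c ij by blast+
      \<comment> \<open>With \<open>L = {i, j}\<close> the premise of \<open>stuck\<close> fails for
        both indices: \<open>v\<close> has two unobserved neighbours and forces neither.\<close>
      have "observed N S \<inter> A i \<subseteq> observed (M i) (S \<inter> A i)"
        using ij nu ne by (intro observed_restrict_delete[OF S'(1) v, of "{i, j}"]) auto
      then show False using nu(1) u_in[OF ij(1)] S'(2) ij(1) by blast
    qed
    then show "card {i \<in> K. a i = b i \<and> 1 + c i \<noteq> a i} \<le> 1"
      using finite_K by (subst One_nat_def, subst card_le_Suc0_iff_eq) auto
  qed
qed

theorem pd_number_branches:
  "pd_number N W {} = (if card {i \<in> K. a i = b i \<and> 1 + c i \<noteq> a i} \<le> 1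
     \<and> {i \<in> K. a i \<noteq> b i} \<noteq> {} then branch_sum else Suc branch_sum)"
    (is "_ = (if ?small then _ else _)")
proof -
  obtain S where S: "S \<in> pd_sets N W" "card S = pd_number N W {}"
    using pd_number_attained[OF finite_W, of "{}" N] by auto
  have lower: "branch_sum \<le> pd_number N W {}"
    and strict: "pd_number N W {} = branch_sum \<Longrightarrow> ?small"
    using pd_set_bound[OF S(1)] unfolding S(2) .
  show ?thesis
  proof (cases ?small)
    case True
    then have "pd_number N W {} \<le> branch_sum" using pd_number_le_branch_sum by blast
    then show ?thesis using lower unfolding if_P[OF True] by (rule order_antisym)
  next
    case False
    then have "pd_number N W {} \<noteq> branch_sum" using strict by blast
    then have "pd_number N W {} = Suc branch_sum"
      using lower pd_number_le_Suc_branch_sum by linarith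
    then show ?thesis unfolding if_not_P[OF False] .
  qed
qed

lemma int_branch_sum: "int branch_sum = - int (card K) + (\<Sum>i\<in>K. int (a i))"
proof -
  have "int (a i - 1) = int (a i) - 1" if "i \<in> K" for i
    using a_attained[OF that] by (metis Suc_diff_1 diff_Suc_1 of_nat_Suc add_diff_cancel_left')
  then have "int branch_sum = (\<Sum>i\<in>K. int (a i) - 1)" by (simp add: branch_sum_def)
  then show ?thesis by (simp add: sum_subtractf)
qed

end

section \<open>Branches of a tree\<close>

lemma nbhd_induce_subgraph: "nbhd (G \<restriction> W) = restrict_nbhd (nbhd G) W"
  by (intro ext) (auto simp: nbhd_def restrict_nbhd_def arcs_ends_conv image_iff)

lemma del_vert_induce_insert:
  "v \<notin> A \<Longrightarrow> pre_digraph.del_vert (G \<restriction> insert v A) v = G \<restriction> A"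
  by (auto simp: pre_digraph.del_vert_def induce_subgraph_def)

lemma (in fin_digraph) fin_digraph_induce:
  "W \<subseteq> verts G \<Longrightarrow> fin_digraph (G \<restriction> W)"
  by (intro fin_digraph_subgraph induced_imp_subgraph induced_induce)

text \<open>Connectedness gives a neighbour of \<open>v\<close> in \<open>C\<close>. Two of them,
  joined by a path inside \<open>C\<close>, would close a cycle through \<open>v\<close>.\<close>

lemma (in graph) unique_nbr_in_component:
  assumes conn: "Digraph_Component.connected G"
    and acyc: "\<not> (\<exists>p. cycle p \<and> 3 \<le> length p)"
    and v: "v \<in> verts G" and C: "C \<in> component_verts (del_vert v)"
  shows "\<exists>!u. u \<in> C \<and> v \<rightarrow> u"
    and "x \<in> C \<Longrightarrow> nbhd G x \<subseteq> insert v C"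
proof -
  let ?D = "del_vert v"
  interpret D: fin_digraph ?D by (rule fin_digraph_del_vert)
  have Dsub: "subgraph ?D G" by (rule subgraph_del_vert)
  have Cs: "C \<in> D.sccs_verts"
    using C by (simp add: component_verts_def D.sccs_verts_conv)
  have CD: "C \<subseteq> verts G - {v}"
    using D.sccs_verts_subsets[OF Cs] by (simp add: verts_del_vert)
  have Dadj: "x \<rightarrow>\<^bsub>?D\<^esub> y" if "x \<rightarrow> y" "x \<noteq> v" "y \<noteq> v" for x y
    using that by (auto simp: arcs_ends_conv arcs_del_vert tail_del_vert head_del_vert image_iff)
  have closed: "y \<in> C" if xy: "x \<in> C" "x \<rightarrow> y" "y \<noteq> v" for x y
  proof -
    have "x \<noteq> v" using xy(1) CD by blast
    then have "x \<rightarrow>\<^bsub>?D\<^esub> y" "y \<rightarrow>\<^bsub>?D\<^esub> x"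
      using Dadj xy graph_symmetric by blast+
    then have "x \<rightarrow>\<^sup>*\<^bsub>?D\<^esub> y" "y \<rightarrow>\<^sup>*\<^bsub>?D\<^esub> x" by auto
    then show ?thesis using Cs xy(1) unfolding D.sccs_verts_def by blast
  qed
  then show "x \<in> C \<Longrightarrow> nbhd G x \<subseteq> insert v C" by (auto simp: nbhd_def)
  have "\<exists>u\<in>C. v \<rightarrow> u"
  proof -
    obtain x where x: "x \<in> C" using Cs by (auto simp: D.sccs_verts_def)
    have "strongly_connected G"
      using symmetric_connected_imp_strongly_connected[OF sym_arcs conn] .
    then have "x \<rightarrow>\<^sup>* v" using x CD v by (auto simp: strongly_connected_def)
    \<comment> \<open>A walk starting in \<open>C\<close> can leave \<open>C\<close> only through
      \<open>v\<close>, hence from a neighbour of \<open>v\<close>.\<close>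
    moreover have "y \<in> C \<or> (\<exists>u\<in>C. v \<rightarrow> u)" if "x \<rightarrow>\<^sup>* y" for y
      using that
    proof (induction rule: reachable_induct)
      case (step y z)
      then show ?case using closed graph_symmetric by metis
    qed (use x in blast)
    ultimately show ?thesis using CD by blast
  qed
  moreover have "x = y" if xy: "x \<in> C" "v \<rightarrow> x" "y \<in> C" "v \<rightarrow> y" for x y
  proof (rule ccontr)
    assume ne: "x \<noteq> y"
    have "x \<rightarrow>\<^sup>*\<^bsub>?D\<^esub> y" using Cs xy unfolding D.sccs_verts_def by blast
    then obtain p where p: "D.apath x p y" using D.reachable_apath by blast
    have "p \<noteq> []" using p ne by (auto simp: D.apath_Nil_iff)
    have "apath x p y" using subgraph_apath_imp_apath[OF p Dsub] .
    have vs: "D.awalk_verts x p = awalk_verts x p"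
      using compatible_awalk_verts Dsub subgraph_def by metis
    have "v \<notin> set (awalk_verts x p)"
      using p vs D.awalkE' unfolding D.apath_def by (metis Diff_iff insertI1 subsetD verts_del_vert)
    obtain e1 where e1: "e1 \<in> arcs G" "tail G e1 = v" "head G e1 = x" using xy(2) by auto
    have "y \<rightarrow> v" using xy(4) graph_symmetric by blast
    then obtain e2 where e2: "e2 \<in> arcs G" "tail G e2 = y" "head G e2 = v" by auto
    have aw: "awalk x p y" "distinct (awalk_verts x p)"
      using \<open>apath x p y\<close> by (auto simp: apath_def)
    have "awalk y [e2] v" using e2 arc_implies_awalk by metis
    then have w: "awalk x (p @ [e2]) v" using aw awalk_appendI by blast
    then have "awalk v (e1 # p @ [e2]) v" using e1 by (metis awalk_Cons_iff)
    \<comment> \<open>\<open>cycle\<close> asks for distinct vertices after the first; the path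
      avoids \<open>v\<close>, so appending \<open>v\<close> keeps them distinct.\<close>
    moreover have "tl (awalk_verts v (e1 # p @ [e2])) = awalk_verts x p @ [v]"
      using awalk_verts_append[OF w] e1 e2 by simp
    ultimately have "cycle (e1 # p @ [e2])"
      unfolding cycle_def using aw(2) \<open>v \<notin> set (awalk_verts x p)\<close>
      by (metis distinct_append distinct_singleton disjoint_insert(1) inf_bot_right list.set(1) list.simps(15) list.distinct(1))
    \<comment> \<open>Two arcs at \<open>v\<close> and at least one arc of \<open>p\<close>, as its
      ends differ.\<close>
    moreover have "3 \<le> length (e1 # p @ [e2])" using \<open>p \<noteq> []\<close> by (cases p) auto
    ultimately show False using acyc by blast
  qed
  ultimately show "\<exists>!u. u \<in> C \<and> v \<rightarrow> u" by blast
qed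

theorem theorem4p2:
  fixes T :: "('a, 'b) pre_digraph" and v :: 'a and k :: nat
    and V :: "nat \<Rightarrow> 'a set" and Ti :: "nat \<Rightarrow> ('a, 'b) pre_digraph"
    and I I' J :: "nat set" and g :: int
  assumes "undirected_tree T"
    and "v \<in> verts T"
    and "card (nbhd T v) \<ge> 2"
    and "bij_betw V {1..k} (component_verts (pre_digraph.del_vert T v))"
    and "\<And>i. i \<in> {1..k} \<Longrightarrow> Ti i = T \<restriction> (V i \<union> {v})"
    and "I = {i \<in> {1..k}. gammaP_containing (Ti i) {v} = gammaP (Ti i) \<and>
               1 + gammaP (pre_digraph.del_vert (Ti i) v) \<noteq> gammaP_containing (Ti i) {v}}"
    and "I' = {i \<in> {1..k}. gammaP_containing (Ti i) {v} = gammaP (Ti i) \<and>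
               1 + gammaP (pre_digraph.del_vert (Ti i) v) = gammaP_containing (Ti i) {v}}"
    and "J = {i \<in> {1..k}. gammaP_containing (Ti i) {v} \<noteq> gammaP (Ti i)}"
    and "g = - int k + (\<Sum>i = 1..k. int (gammaP_containing (Ti i) {v}))"
  shows "(card I \<ge> 2 \<or> card J = 0 \<longrightarrow> int (gammaP T) = g + 1) \<and>
         (card I \<le> 1 \<and> card J \<ge> 1 \<longrightarrow> int (gammaP T) = g)"
proof -
  interpret graph T using assms(1) by (simp add: undirected_tree_def)
  interpret D: fin_digraph "del_vert v" by (rule fin_digraph_del_vert)
  have tree: "Digraph_Component.connected T" "\<not> (\<exists>p. cycle p \<and> 3 \<le> length p)"
    using assms(1) by (auto simp: undirected_tree_def)
  let ?K = "{1..k}"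
  have V: "V i \<in> component_verts (del_vert v)" if "i \<in> ?K" for i
    using assms(4) that by (auto simp: bij_betw_def)
  have Vs: "component_verts (del_vert v) = D.sccs_verts"
    by (simp add: component_verts_def D.sccs_verts_conv)
  have V_sub: "V i \<subseteq> verts T - {v}" if "i \<in> ?K" for i
    using D.sccs_verts_subsets V[OF that] Vs by (simp add: verts_del_vert)
  have V_cover: "(\<Union>i\<in>?K. V i) = verts T - {v}"
  proof
    show "verts T - {v} \<subseteq> (\<Union>i\<in>?K. V i)"
    proof
      fix x assume "x \<in> verts T - {v}"
      then have x: "x \<in> verts (del_vert v)" by (simp add: verts_del_vert)
      then have "D.scc_of x \<in> V ` ?K"
        using D.scc_of_in_sccs_verts Vs assms(4) by (simp add: bij_betw_def)
      then show "x \<in> (\<Union>i\<in>?K. V i)" using D.in_scc_of_self[OF x] by auto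
    qed
  qed (use V_sub in blast)
  define u where "u i = (THE x. x \<in> V i \<and> v \<rightarrow>\<^bsub>T\<^esub> x)" for i
  have u: "x \<in> V i \<and> v \<rightarrow>\<^bsub>T\<^esub> x \<longleftrightarrow> x = u i" if "i \<in> ?K" for i x
    using theI'[OF unique_nbr_in_component(1)[OF tree assms(2) V[OF that]], folded u_def]
      unique_nbr_in_component(1)[OF tree assms(2) V[OF that]] by blast
  interpret branches "nbhd T" v ?K V u
  proof
    show "finite ?K" by simp
    fix i assume i: "i \<in> ?K"
    show "finite (V i)" using V_sub[OF i] finite_verts by (meson finite_Diff finite_subset)
    show "v \<notin> V i" using V_sub[OF i] by blast
    show "u i \<in> V i" using u[OF i] by blast
    show "i = j" if "j \<in> ?K" "x \<in> V i" "x \<in> V j" for j x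
    proof -
      \<comment> \<open>Distinct components are disjoint; injectivity of \<open>V\<close> then
        identifies the indices.\<close>
      have "V i = V j" using D.sccs_verts_disjoint[of "V i" "V j"] V that i Vs by blast
      then show ?thesis using inj_onD[OF bij_betw_imp_inj_on[OF assms(4)]] i that(1) by blast
    qed
    show "nbhd T x \<subseteq> insert v (V i)" if "x \<in> V i" for x
      using unique_nbr_in_component(2)[OF tree assms(2) V[OF i] that] .
    show "v \<in> nbhd T x \<longleftrightarrow> x = u i" if "x \<in> V i" for x
      using u[OF i, of x] that graph_symmetric by (auto simp: nbhd_def)
  next
    show "nbhd T v = u ` ?K"
    proof
      show "nbhd T v \<subseteq> u ` ?K"
      proof
        fix x assume x: "x \<in> nbhd T v"
        then have "x \<in> verts T - {v}" using nbhd_subset_verts no_loops adj_not_same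
          by (auto simp: nbhd_def)
        then obtain i where i: "i \<in> ?K" "x \<in> V i" using V_cover by blast
        then have "x = u i" using u[OF i(1), of x] x by (simp add: nbhd_def)
        then show "x \<in> u ` ?K" using i(1) by (rule image_eqI)
      qed
      have "u i \<in> nbhd T v" if "i \<in> ?K" for i using u[OF that, of "u i"] by (simp add: nbhd_def)
      then show "u ` ?K \<subseteq> nbhd T v" by blast
    qed
  qed
  have W: "W = verts T" using V_cover assms(2) by auto
  have Ti: "Ti i = T \<restriction> insert v (V i)" if "i \<in> ?K" for i using assms(5)[OF that] by simp
  have fin: "fin_digraph (T \<restriction> insert v (V i))" "fin_digraph (T \<restriction> V i)" if "i \<in> ?K" for i
    using V_sub[OF that] assms(2) by (auto intro!: fin_digraph_induce)
  have a: "gammaP_containing (Ti i) {v} = a i" and b: "gammaP (Ti i) = b i"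
    and c: "gammaP (pre_digraph.del_vert (Ti i) v) = c i" if "i \<in> ?K" for i
    using fin_digraph.gammaP_containing_eq[OF fin(1)[OF that]] fin_digraph.gammaP_eq[OF fin(1)[OF that]]
      fin_digraph.gammaP_eq[OF fin(2)[OF that]] Ti[OF that] v_notin[OF that]
    by (auto simp: nbhd_induce_subgraph del_vert_induce_insert)
  have I: "I = {i \<in> ?K. a i = b i \<and> 1 + c i \<noteq> a i}" and J: "J = {i \<in> ?K. a i \<noteq> b i}"
    unfolding assms(6,8) using a b c by (metis (lifting))+
  have g: "g = int branch_sum" unfolding assms(9) int_branch_sum using a by simp
  have finJ: "finite J" unfolding J by simp
  \<comment> \<open>The two cases of the theorem are this condition and its negation, once
    \<open>card J = 0\<close> is read as \<open>J = {}\<close>.\<close>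
  have gammaP: "gammaP T = (if card I \<le> 1 \<and> J \<noteq> {} then branch_sum else Suc branch_sum)"
    unfolding gammaP_eq W[symmetric] pd_number_branches I[symmetric] J[symmetric] ..
  have "card J = 0 \<longleftrightarrow> J = {}" using finJ by simp
  then show ?thesis unfolding gammaP g by auto
qed

end
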